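(* Let $\mathcal{C}$ be a set, let $\mathrm{safe}:\mathcal{C}\to\mathcal{M}$ be a function into the set $\mathcal M$ of conditional generative models, and write $\mathrm{safe}_C=\mathrm{safe}(C)$. Let $x\in\mathcal{X}$ be a prompt and suppose the model $p\in\mathcal M$ is $k_x$-near access-free on prompt $x$ with respect to $\mathcal{C}$, $\mathrm{safe}$ and $\Delta=\Delta_{\mathrm{KL}}$. Let $\varepsilon_x,\delta_x\ge 0$, let $C\in\mathcal C$, and suppose that the random variable \[ Y_x=\log\frac{p(y|x)}{\mathrm{safe}_C(y|x)},\qquad y\sim p(\cdot|x), \] is $(\varepsilon_x,\delta_x)$-concentrated. Then for every event $\mathcal{E}\subseteq\mathcal{Y}$, \[ p(\mathcal{E}|x)\;\le\;2^{(1+\varepsilon_x)k_x}\cdot \mathrm{safe}_C(\mathcal{E}|x)+\delta_x. \]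
   Context: $\mathcal X$ is a set of prompts and $\mathcal Y$ a discrete (countable) set of outputs. A conditional generative model $p\in\mathcal M$ assigns to each $x\in\mathcal X$ a probability mass function $p(\cdot|x)$ on $\mathcal Y$; for $\mathcal E\subseteq\mathcal Y$, $p(\mathcal E|x)=\sum_{y\in\mathcal E}p(y|x)$. All logarithms are base 2. For distributions $\rho,\mu$ on $\mathcal Y$, $\Delta_{\mathrm{KL}}(\rho\|\mu)=\mathbb E_{y\sim\rho}\left[\log\frac{\rho(y)}{\mu(y)}\right]$ (equal to $+\infty$ if $\rho$ is not absolutely continuous with respect to $\mu$). Given a set $\mathcal C$, a function $\mathrm{safe}:\mathcal C\to\mathcal M$ and a divergence $\Delta$, a model $p$ is $k_x$-near access-free ($k_x$-NAF) on prompt $x$ with respect to $\mathcal C$, $\mathrm{safe}$, $\Delta$ if $\Delta\bigl(p(\cdot|x)\,\|\,\mathrm{safe}_C(\cdot|x)\bigr)\le k_x$ for every $C\in\mathcal C$. A real random variable $X$ is $(\varepsilon,\delta)$-concentrated if $\Pr\bigl[X\notin(1\pm\varepsilon)\mathbb E[X]\bigr]\le\delta$, where $(1\pm\varepsilon)\mathbb E[X]$ denotes the closed interval with endpoints $(1-\varepsilon)\mathbb E[X]$ and $(1+\varepsilon)\mathbb E[X]$. *)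

theory Defs
  imports "HOL-Probability.Probability"
begin

text \<open>The set of prompts is the type \<open>'x\<close>, the set of outputs the type \<open>'y\<close>.\<close>

type_synonym ('x, 'y) model = "'x \<Rightarrow> 'y pmf"

text \<open>
  Expectation of a real random variable with values in the extended reals, as the difference of
  the expectations of the positive and the negative part (\<^const>\<open>ennreal\<close> sends negative reals
  to 0). The Bochner integral is not suitable for the divergence below, since it is 0 on
  functions that are not integrable.
\<close>

definition ext_expectation :: "'a measure \<Rightarrow> ('a \<Rightarrow> real) \<Rightarrow> ereal" where
  "ext_expectation M X =
     enn2ereal (\<integral>\<^sup>+ w. ennreal (X w) \<partial>M) - enn2ereal (\<integral>\<^sup>+ w. ennreal (- X w) \<partial>M)"

text \<open>
  \<open>absolutely_continuous M N\<close> says that \<open>N\<close> is absolutely continuous with respect to \<open>M\<close>.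
  If \<open>\<rho>\<close> is absolutely continuous with respect to \<open>\<mu>\<close>, then the negative part of the log-ratio
  has finite expectation under \<open>\<rho>\<close>, so that the difference in \<^const>\<open>ext_expectation\<close> is never
  \<open>\<infinity> - \<infinity>\<close>. The library's \<^const>\<open>KL_divergence\<close> is real-valued and cannot express the value
  \<open>\<infinity>\<close>.
\<close>

definition kl_div :: "'y pmf \<Rightarrow> 'y pmf \<Rightarrow> ereal" where
  "kl_div \<rho> \<mu> =
     (if absolutely_continuous (measure_pmf \<mu>) (measure_pmf \<rho>)
      then ext_expectation (measure_pmf \<rho>) (\<lambda>y. log 2 (pmf \<rho> y / pmf \<mu> y))
      else \<infinity>)"

definition near_access_free ::
  "'c set \<Rightarrow> ('c \<Rightarrow> ('x, 'y) model) \<Rightarrow> ('y pmf \<Rightarrow> 'y pmf \<Rightarrow> ereal) \<Rightarrow> real \<Rightarrow> 'x \<Rightarrow>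
   ('x, 'y) model \<Rightarrow> bool" where
  "near_access_free \<C> safe \<Delta> k x p \<longleftrightarrow> (\<forall>C\<in>\<C>. \<Delta> (p x) (safe C x) \<le> ereal k)"

text \<open>
  The expectation of \<open>X\<close> may be negative, in which case \<open>(1 + \<epsilon>) * expectation\<close> is the lower
  endpoint; \<^const>\<open>closed_segment\<close> does not depend on the order of the endpoints. The definition is
  meaningful for integrable \<open>X\<close>. Integrability is not required here; for the log-ratio
  of two distributions it follows from finiteness of \<^const>\<open>kl_div\<close>.
\<close>

definition concentrated :: "'a measure \<Rightarrow> ('a \<Rightarrow> real) \<Rightarrow> real \<Rightarrow> real \<Rightarrow> bool" where
  "concentrated M X \<epsilon> \<delta> \<longleftrightarrow>
     \<P>(w in M. X w \<notin> closed_segment ((1 - \<epsilon>) * integral\<^sup>L M X) ((1 + \<epsilon>) * integral\<^sup>L M X)) \<le> \<delta>"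

end

theory Submission imports Defs begin

text \<open>
  The bound \<open>ln t \<le> t - 1\<close>, applied to \<open>t = \<mu> y / \<rho> y\<close>, whose expectation under \<open>\<rho>\<close> is at
  most 1, shows that the negative part of the log-ratio is integrable and that its mean is
  nonnegative. Finiteness of the divergence then makes the log-ratio integrable with mean \<open>m\<close>
  in \<open>[0, k]\<close>, so that the upper end of the concentration interval is at most \<open>(1 + \<epsilon>) k\<close>. On the
  outputs whose log-ratio lies in that interval, \<open>\<rho>\<close> is pointwise at most
  \<open>2 powr ((1 + \<epsilon>) k)\<close> times \<open>\<mu>\<close>; the others have \<open>\<rho>\<close>-probability at most \<open>\<delta>\<close>.
\<close>

text \<open>The probability of \<open>A\<close> is the sum of the mass function over
  \<open>A\<close>, so a pointwise bound on \<open>A\<close> alone sums up. It will serve for the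
  event with the badly concentrated outputs removed.\<close>

lemma prob_pmf_le_mult:
  assumes "c \<ge> 0" and le: "\<And>y. y \<in> A \<Longrightarrow> pmf \<rho> y \<le> c * pmf \<mu> y"
  shows "measure_pmf.prob \<rho> A \<le> c * measure_pmf.prob \<mu> A"
proof -
  have "ennreal (measure_pmf.prob \<rho> A) = (\<integral>\<^sup>+ y. ennreal (pmf \<rho> y) \<partial>count_space A)"
    by (simp add: nn_integral_pmf measure_pmf.emeasure_eq_measure)
  also have "\<dots> \<le> (\<integral>\<^sup>+ y. ennreal c * ennreal (pmf \<mu> y) \<partial>count_space A)"
    using le \<open>c \<ge> 0\<close> by (intro nn_integral_mono) (simp flip: ennreal_mult)
  also have "\<dots> = ennreal (c * measure_pmf.prob \<mu> A)"
    using \<open>c \<ge> 0\<close>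
    by (simp add: nn_integral_cmult nn_integral_pmf measure_pmf.emeasure_eq_measure ennreal_mult)
  finally show ?thesis
    using \<open>c \<ge> 0\<close> by simp
qed

text \<open>The weight \<open>pmf \<rho> y\<close> cancels the denominator on the support of
  \<open>\<rho>\<close>; off it the product is 0. What remains is the \<open>\<mu>\<close>-mass of
  that support, which may be less than 1.\<close>

lemma nn_integral_pmf_ratio_le_1:
  "(\<integral>\<^sup>+ y. ennreal (pmf \<mu> y / pmf \<rho> y) \<partial>measure_pmf \<rho>) \<le> 1"
proof -
  have "(\<integral>\<^sup>+ y. ennreal (pmf \<mu> y / pmf \<rho> y) \<partial>measure_pmf \<rho>)
      = (\<integral>\<^sup>+ y. ennreal (pmf \<rho> y) * ennreal (pmf \<mu> y / pmf \<rho> y) \<partial>count_space UNIV)"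
    by (rule nn_integral_measure_pmf)
  also have "\<dots> \<le> (\<integral>\<^sup>+ y. ennreal (pmf \<mu> y) \<partial>count_space UNIV)"
    by (intro nn_integral_mono) (simp flip: ennreal_mult)
  also have "\<dots> = 1"
    by (simp add: nn_integral_pmf)
  finally show ?thesis .
qed

lemma
  shows integrable_pmf_ratio: "integrable (measure_pmf \<rho>) (\<lambda>y. pmf \<mu> y / pmf \<rho> y)"
    and expectation_pmf_ratio_le_1: "measure_pmf.expectation \<rho> (\<lambda>y. pmf \<mu> y / pmf \<rho> y) \<le> 1"
proof -
  show *: "integrable (measure_pmf \<rho>) (\<lambda>y. pmf \<mu> y / pmf \<rho> y)"
    using nn_integral_pmf_ratio_le_1[of \<rho> \<mu>]
    by (intro integrableI_nonneg) (auto intro: le_less_trans)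
  have "ennreal (measure_pmf.expectation \<rho> (\<lambda>y. pmf \<mu> y / pmf \<rho> y)) \<le> ennreal 1"
    using nn_integral_pmf_ratio_le_1[of \<rho> \<mu>] nn_integral_eq_integral[OF *] by simp
  then show "measure_pmf.expectation \<rho> (\<lambda>y. pmf \<mu> y / pmf \<rho> y) \<le> 1"
    by (subst (asm) ennreal_le_iff) auto
qed

text \<open>Absolute continuity is tested on the singleton \<open>{y}\<close>. On the support of
  \<open>\<rho>\<close> the log-ratio is thus the logarithm of a positive number, free of default
  values for division and \<open>log\<close>.\<close>

lemma absolutely_continuous_pmf_pos:
  assumes "absolutely_continuous (measure_pmf \<mu>) (measure_pmf \<rho>)" and "y \<in> set_pmf \<rho>"
  shows "pmf \<mu> y > 0"
proof (rule ccontr)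
  assume "\<not> pmf \<mu> y > 0"
  then have "{y} \<in> null_sets (measure_pmf \<mu>)"
    by (simp add: null_sets_def emeasure_pmf_single order_less_le)
  then have "{y} \<in> null_sets (measure_pmf \<rho>)"
    using assms(1) unfolding absolutely_continuous_def by blast
  then show False
    using assms(2) by (simp add: null_sets_def emeasure_pmf_single set_pmf_iff)
qed

lemma minus_log_pmf_ratio_le:
  assumes "absolutely_continuous (measure_pmf \<mu>) (measure_pmf \<rho>)" and "y \<in> set_pmf \<rho>"
  shows "- log 2 (pmf \<rho> y / pmf \<mu> y) \<le> (pmf \<mu> y / pmf \<rho> y - 1) / ln 2"
proof -
  have pos: "pmf \<mu> y > 0" "pmf \<rho> y > 0"
    using absolutely_continuous_pmf_pos[OF assms] assms(2) by (simp_all add: pmf_positive)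
  then have "- log 2 (pmf \<rho> y / pmf \<mu> y) = ln (pmf \<mu> y / pmf \<rho> y) / ln 2"
    by (simp add: log_def ln_div field_simps)
  also have "\<dots> \<le> (pmf \<mu> y / pmf \<rho> y - 1) / ln 2"
    using pos by (intro divide_right_mono ln_le_minus_one) auto
  finally show ?thesis .
qed

lemma kl_div_le_imp_integrable:
  assumes "kl_div \<rho> \<mu> \<le> ereal k"
  defines "Y \<equiv> \<lambda>y. log 2 (pmf \<rho> y / pmf \<mu> y)"
  shows "absolutely_continuous (measure_pmf \<mu>) (measure_pmf \<rho>)"
    and "integrable (measure_pmf \<rho>) Y"
    and "measure_pmf.expectation \<rho> Y \<le> k"
proof -
  show ac: "absolutely_continuous (measure_pmf \<mu>) (measure_pmf \<rho>)"
    using assms by (auto simp: kl_div_def split: if_splits)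
  let ?P = "\<integral>\<^sup>+ y. ennreal (Y y) \<partial>measure_pmf \<rho>"
  let ?N = "\<integral>\<^sup>+ y. ennreal (- Y y) \<partial>measure_pmf \<rho>"
  have le: "enn2ereal ?P - enn2ereal ?N \<le> ereal k"
    using assms ac by (simp add: kl_div_def ext_expectation_def)
  \<comment> \<open>Dropping the \<open>- 1\<close> from the bound on the negative log-ratio leaves
    a nonnegative integrable majorant.\<close>
  have "?N \<le> (\<integral>\<^sup>+ y. ennreal (pmf \<mu> y / pmf \<rho> y / ln 2) \<partial>measure_pmf \<rho>)"
  proof (intro nn_integral_mono_AE AE_pmfI ennreal_leI)
    fix y assume "y \<in> set_pmf \<rho>"
    from minus_log_pmf_ratio_le[OF ac this]
    show "- Y y \<le> pmf \<mu> y / pmf \<rho> y / ln 2"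
      unfolding Y_def by (rule order_trans) (intro divide_right_mono, auto)
  qed
  also have "\<dots> < \<infinity>"
    using integrable_divide[OF integrable_pmf_ratio[of \<rho> \<mu>], of "ln 2"]
    by (subst nn_integral_eq_integral) auto
  finally have N: "?N \<noteq> \<infinity>" by simp
  have P: "?P \<noteq> \<infinity>"
  proof
    \<comment> \<open>With \<open>?N\<close> finite, the difference in \<open>le\<close> would be
      infinite, yet it is bounded by the real \<open>k\<close>.\<close>
    assume "?P = \<infinity>"
    with le N show False
      by (cases ?N rule: ennreal_cases) auto
  qed
  show int: "integrable (measure_pmf \<rho>) Y"
    using P N by (simp add: real_integrable_def)
  obtain a b where ab: "?P = ennreal a" "a \<ge> 0" "?N = ennreal b" "b \<ge> 0"
    using P N by (metis ennreal_cases infinity_ennreal_def)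
  then have "measure_pmf.expectation \<rho> Y = a - b"
    using real_lebesgue_integral_def[OF int] by simp
  moreover have "a - b \<le> k"
    using le ab by (simp add: enn2ereal_ennreal)
  ultimately show "measure_pmf.expectation \<rho> Y \<le> k" by simp
qed

text \<open>Gibbs' inequality, obtained by integrating the pointwise bound on the negative
  log-ratio.\<close>

lemma expectation_log_pmf_ratio_nonneg:
  assumes ac: "absolutely_continuous (measure_pmf \<mu>) (measure_pmf \<rho>)"
    and int: "integrable (measure_pmf \<rho>) (\<lambda>y. log 2 (pmf \<rho> y / pmf \<mu> y))"
  shows "measure_pmf.expectation \<rho> (\<lambda>y. log 2 (pmf \<rho> y / pmf \<mu> y)) \<ge> 0"
proof -
  note ratio = integrable_pmf_ratio[of \<rho> \<mu>]
  have "measure_pmf.expectation \<rho> (\<lambda>y. - log 2 (pmf \<rho> y / pmf \<mu> y))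
      \<le> measure_pmf.expectation \<rho> (\<lambda>y. (pmf \<mu> y / pmf \<rho> y - 1) / ln 2)"
    using int ratio minus_log_pmf_ratio_le[OF ac]
    by (intro integral_mono_AE AE_pmfI) auto
  also have "\<dots> = (measure_pmf.expectation \<rho> (\<lambda>y. pmf \<mu> y / pmf \<rho> y) - 1) / ln 2"
    using ratio by simp
  also have "\<dots> \<le> 0"
    using expectation_pmf_ratio_le_1[of \<rho> \<mu>] by (intro divide_nonpos_pos) auto
  finally show ?thesis by simp
qed

theorem lemma2p3:
  fixes \<C> :: "'c set"
    and safe :: "'c \<Rightarrow> ('x, 'y::countable) model"
    and p :: "('x, 'y) model"
    and x :: 'x
    and C :: 'c
    and k \<epsilon> \<delta> :: real
    and \<E> :: "'y set"
  assumes "near_access_free \<C> safe kl_div k x p"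
    and "\<epsilon> \<ge> 0" and "\<delta> \<ge> 0"
    and "C \<in> \<C>"
    and "concentrated (measure_pmf (p x)) (\<lambda>y. log 2 (pmf (p x) y / pmf (safe C x) y)) \<epsilon> \<delta>"
  shows "measure_pmf.prob (p x) \<E> \<le>
           2 powr ((1 + \<epsilon>) * k) * measure_pmf.prob (safe C x) \<E> + \<delta>"
proof -
  let ?\<rho> = "p x" and ?\<mu> = "safe C x" and ?c = "2 powr ((1 + \<epsilon>) * k)"
  define Y where "Y = (\<lambda>y. log 2 (pmf ?\<rho> y / pmf ?\<mu> y))"
  define m where "m = measure_pmf.expectation ?\<rho> Y"
  define B where "B = {y. Y y \<notin> closed_segment ((1 - \<epsilon>) * m) ((1 + \<epsilon>) * m)}"
  have kl: "kl_div ?\<rho> ?\<mu> \<le> ereal k"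
    using assms by (simp add: near_access_free_def)
  note ac = kl_div_le_imp_integrable(1)[OF kl]
  have m: "0 \<le> m" "m \<le> k"
    using kl_div_le_imp_integrable[OF kl] expectation_log_pmf_ratio_nonneg[OF ac]
    by (simp_all add: m_def Y_def)
  have B: "measure_pmf.prob ?\<rho> B \<le> \<delta>"
    using assms(5) by (simp add: concentrated_def B_def m_def Y_def)
  have "pmf ?\<rho> y \<le> ?c * pmf ?\<mu> y" if "y \<in> \<E> - B" for y
  \<comment> \<open>On the support the bound on \<open>Y y\<close> can be exponentiated; off it the
    left-hand side is 0.\<close>
  proof (cases "y \<in> set_pmf ?\<rho>")
    case True
    have pos: "pmf ?\<mu> y > 0" "pmf ?\<rho> y > 0"
      using absolutely_continuous_pmf_pos[OF ac True] True by (simp_all add: pmf_positive)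
    \<comment> \<open>Here \<open>0 \<le> m\<close> matters: it orders the endpoints, so that
      \<open>(1 + \<epsilon>) * m\<close> is the upper one.\<close>
    have "(1 - \<epsilon>) * m \<le> (1 + \<epsilon>) * m"
      using m \<open>\<epsilon> \<ge> 0\<close> by (intro mult_right_mono) auto
    then have "Y y \<le> (1 + \<epsilon>) * m"
      using that by (auto simp: B_def closed_segment_eq_real_ivl)
    also have "\<dots> \<le> (1 + \<epsilon>) * k"
      using m \<open>\<epsilon> \<ge> 0\<close> by (intro mult_left_mono) auto
    finally have "pmf ?\<rho> y / pmf ?\<mu> y \<le> ?c"
      using pos by (simp add: Y_def log_le_iff)
    then show ?thesis
      using pos by (simp add: field_simps)
  qed (simp add: set_pmf_iff)
  then have "measure_pmf.prob ?\<rho> (\<E> - B) \<le> ?c * measure_pmf.prob ?\<mu> (\<E> - B)"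
    by (intro prob_pmf_le_mult) auto
  also have "\<dots> \<le> ?c * measure_pmf.prob ?\<mu> \<E>"
    by (intro mult_left_mono measure_pmf.finite_measure_mono) auto
  finally have good: "measure_pmf.prob ?\<rho> (\<E> - B) \<le> ?c * measure_pmf.prob ?\<mu> \<E>" .
  have "measure_pmf.prob ?\<rho> \<E> \<le> measure_pmf.prob ?\<rho> ((\<E> - B) \<union> B)"
    by (intro measure_pmf.finite_measure_mono) auto
  also have "\<dots> \<le> measure_pmf.prob ?\<rho> (\<E> - B) + measure_pmf.prob ?\<rho> B"
    by (intro measure_Un_le) auto
  finally show ?thesis
    using good B by simp
qed

end
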